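(* Let $\gamma$ be a closure operator on a domain $P$, and let $\mathrm{sc}(\gamma)$ be the Scott-continuous core of $\gamma$. Then for all $x\in P$ we have $$\mathrm{sc}(\gamma)(x)=\bigvee\gamma(\{u\in P: u\ll x\})=\bigvee\{\gamma(u): u\in P,\ u\ll x\}.$$
   Context: A dcpo is a poset in which every directed (in particular nonempty) subset has a join. A closure operator on $P$ is a map $P\to P$ that is increasing, ascending ($x\le\gamma(x)$) and idempotent; closure operators are ordered pointwise. A map is Scott-continuous if it preserves joins of directed subsets. On a dcpo $P$, for every closure operator $\gamma$ there exists the greatest of all Scott-continuous closure operators on $P$ that are below $\gamma$; it is denoted $\mathrm{sc}(\gamma)$ and called the Scott-continuous core of $\gamma$. For $x,y\in P$, $x$ is way below $y$, written $x\ll y$, if for every directed subset $D$ of $P$ having a join, $y\le\bigvee D$ implies $x\le d$ for some $d\in D$. A poset $P$ is continuous if for every $x\in P$ the set $\{u\in P: u\ll x\}$ is directed and its join in $P$ is $x$. A domain is a continuous dcpo. *)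

theory Defs
  imports "HOL-Library.Lub_Glb"
begin

text \<open>
  The poset \<open>P\<close> is (the universe of) a type of class \<^class>\<open>order\<close>, so that
  \<^term>\<open>isLub UNIV A s\<close> says that the join of \<open>A\<close> in \<open>P\<close> exists and equals \<open>s\<close>. Self-maps of
  \<open>P\<close> are compared pointwise, by the library order on functions. The properties of being a dcpo,
  a continuous poset or a domain are predicates of the type.
\<close>

definition directed :: "'a::order set \<Rightarrow> bool" where
  "directed D \<longleftrightarrow> D \<noteq> {} \<and> (\<forall>x\<in>D. \<forall>y\<in>D. \<exists>z\<in>D. x \<le> z \<and> y \<le> z)"

definition dcpo :: "'a::order itself \<Rightarrow> bool" where
  "dcpo (_ :: 'a itself) \<longleftrightarrow> (\<forall>D :: 'a set. directed D \<longrightarrow> (\<exists>s. isLub UNIV D s))"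

definition way_below :: "'a::order \<Rightarrow> 'a \<Rightarrow> bool" (infix "\<lless>" 50) where
  "x \<lless> y \<longleftrightarrow> (\<forall>D s. directed D \<longrightarrow> isLub UNIV D s \<longrightarrow> y \<le> s \<longrightarrow> (\<exists>d\<in>D. x \<le> d))"

definition continuous_poset :: "'a::order itself \<Rightarrow> bool" where
  "continuous_poset (_ :: 'a itself) \<longleftrightarrow>
    (\<forall>x :: 'a. directed {u. u \<lless> x} \<and> isLub UNIV {u. u \<lless> x} x)"

definition continuous_domain :: "'a::order itself \<Rightarrow> bool" where
  "continuous_domain T \<longleftrightarrow> dcpo T \<and> continuous_poset T"

definition closure_operator :: "('a::order \<Rightarrow> 'a) \<Rightarrow> bool" where
  "closure_operator \<gamma> \<longleftrightarrow> mono \<gamma> \<and> (\<forall>x. x \<le> \<gamma> x) \<and> (\<forall>x. \<gamma> (\<gamma> x) = \<gamma> x)"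

definition scott_continuous :: "('a::order \<Rightarrow> 'b::order) \<Rightarrow> bool" where
  "scott_continuous f \<longleftrightarrow> (\<forall>D s. directed D \<longrightarrow> isLub UNIV D s \<longrightarrow> isLub UNIV (f ` D) (f s))"

text \<open>On a dcpo the greatest element exists; see \<open>sc_is_core\<close> below.\<close>

definition sc :: "('a::order \<Rightarrow> 'a) \<Rightarrow> 'a \<Rightarrow> 'a" where
  "sc \<gamma> = (GREATEST \<delta>. closure_operator \<delta> \<and> scott_continuous \<delta> \<and> \<delta> \<le> \<gamma>)"

lemma isLub_UNIV_iff:
  "isLub UNIV A s \<longleftrightarrow> (\<forall>a\<in>A. a \<le> s) \<and> (\<forall>t. (\<forall>a\<in>A. a \<le> t) \<longrightarrow> s \<le> t)"
  by (auto simp: isLub_def leastP_def isUb_def setle_def setge_def)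

text \<open>
  Scott-continuous closure operators need not be closed under composition, but the ascending
  Scott-continuous maps below \<open>\<gamma>\<close> are; hence these form a directed set, whose pointwise join is
  idempotent and is the core.
\<close>

lemma sc_is_core:
  fixes \<gamma> :: "'a::order \<Rightarrow> 'a"
  assumes P: "dcpo TYPE('a)" and \<gamma>: "closure_operator \<gamma>"
  shows "closure_operator (sc \<gamma>)" "scott_continuous (sc \<gamma>)" "sc \<gamma> \<le> \<gamma>"
    "\<And>\<delta>. closure_operator \<delta> \<Longrightarrow> scott_continuous \<delta> \<Longrightarrow> \<delta> \<le> \<gamma> \<Longrightarrow> \<delta> \<le> sc \<gamma>"
proof -
  define M where "M = {f. mono f \<and> (\<forall>x. x \<le> f x) \<and> scott_continuous f \<and> f \<le> \<gamma>}"
  have \<gamma>_mono: "mono \<gamma>" and \<gamma>_asc: "x \<le> \<gamma> x" and \<gamma>_idem: "\<gamma> (\<gamma> x) = \<gamma> x" for x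
    using \<gamma> by (auto simp: closure_operator_def)
  have id_M: "(\<lambda>x. x) \<in> M"
    by (auto simp: M_def mono_def scott_continuous_def le_fun_def \<gamma>_asc)
  have comp_M: "(\<lambda>x. f (g x)) \<in> M" if f: "f \<in> M" and g: "g \<in> M" for f g
  proof -
    have "directed (g ` D)" if "directed D" for D
    proof -
      have "\<exists>z\<in>D. g x \<le> g z \<and> g y \<le> g z" if xy: "x \<in> D" "y \<in> D" for x y
      proof -
        obtain z where "z \<in> D" "x \<le> z" "y \<le> z"
          using \<open>directed D\<close> xy unfolding directed_def by blast
        then show ?thesis
          using g by (auto simp: M_def mono_def)
      qed
      then show ?thesis
        using that by (auto simp: directed_def)
    qed
    then have "isLub UNIV (f ` g ` D) (f (g s))" if "directed D" "isLub UNIV D s" for D s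
      using f g that by (auto simp: M_def scott_continuous_def)
    then have "scott_continuous (\<lambda>x. f (g x))"
      by (simp add: scott_continuous_def image_image)
    moreover have "f (g x) \<le> \<gamma> x" for x
    proof -
      have "f (g x) \<le> \<gamma> (g x)" using f by (simp add: M_def le_fun_def)
      also have "\<dots> \<le> \<gamma> (\<gamma> x)" using g \<gamma>_mono by (simp add: M_def le_fun_def mono_def)
      finally show ?thesis by (simp add: \<gamma>_idem)
    qed
    moreover have "x \<le> f (g x)" for x
    proof -
      have "x \<le> g x" using g by (simp add: M_def)
      also have "\<dots> \<le> f (g x)" using f by (simp add: M_def)
      finally show ?thesis .
    qed
    ultimately show ?thesis
      using f g by (auto simp: M_def mono_def le_fun_def)
  qed
  have "\<exists>s. isLub UNIV {f x | f. f \<in> M} s" for x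
  proof -
    have "\<exists>h\<in>M. f x \<le> h x \<and> g x \<le> h x" if f: "f \<in> M" and g: "g \<in> M" for f g
      using f g by (intro bexI[OF _ comp_M[OF f g]]) (auto simp: M_def mono_def)
    then have "directed {f x | f. f \<in> M}"
      using id_M unfolding directed_def by blast
    then show ?thesis
      using P by (auto simp: dcpo_def)
  qed
  then have "\<forall>x. \<exists>s. isLub UNIV {f x | f. f \<in> M} s" ..
  from choice[OF this] obtain c where c: "isLub UNIV {f x | f. f \<in> M} (c x)" for x
    by auto
  have c_ub: "f x \<le> c x" if "f \<in> M" for f x
    using c[of x] that unfolding isLub_UNIV_iff by blast
  have c_least: "c x \<le> t" if "\<And>f. f \<in> M \<Longrightarrow> f x \<le> t" for x t
    using c[of x] that unfolding isLub_UNIV_iff by blast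
  have c_mono: "c x \<le> c y" if "x \<le> y" for x y
  proof (rule c_least)
    fix f assume f: "f \<in> M"
    then have "f x \<le> f y" using that by (simp add: M_def mono_def)
    also have "\<dots> \<le> c y" using f by (rule c_ub)
    finally show "f x \<le> c y" .
  qed
  have c_asc: "x \<le> c x" for x
    using c_ub[OF id_M] .
  have c_le: "c \<le> \<gamma>"
    by (auto simp: le_fun_def M_def intro!: c_least)
  have c_scott: "scott_continuous c"
    unfolding scott_continuous_def
  proof (intro allI impI)
    fix D :: "'a set" and s assume D: "directed D" and s: "isLub UNIV D s"
    show "isLub UNIV (c ` D) (c s)"
      unfolding isLub_UNIV_iff
    proof (intro conjI ballI allI impI)
      fix a assume "a \<in> c ` D"
      then show "a \<le> c s"
        using s by (auto simp: isLub_UNIV_iff intro: c_mono)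
    next
      fix t assume t: "\<forall>a\<in>c ` D. a \<le> t"
      show "c s \<le> t"
      proof (rule c_least)
        fix f assume f: "f \<in> M"
        have "isLub UNIV (f ` D) (f s)"
          using f D s by (simp add: M_def scott_continuous_def)
        moreover have "f d \<le> t" if "d \<in> D" for d
          using c_ub[OF f, of d] t that by (auto intro: order_trans)
        ultimately show "f s \<le> t"
          by (simp add: isLub_UNIV_iff)
      qed
    qed
  qed
  have c_M: "c \<in> M"
    using c_mono c_asc c_scott c_le by (simp add: M_def mono_def)
  have "c (c x) = c x" for x
    using c_ub[OF comp_M[OF c_M c_M], of x] c_asc by (intro antisym)
  then have c_clos: "closure_operator c"
    using c_mono c_asc by (simp add: closure_operator_def mono_def)
  have c_greatest: "\<delta> \<le> c" if "closure_operator \<delta>" "scott_continuous \<delta>" "\<delta> \<le> \<gamma>" for \<delta>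
    using that by (auto simp: le_fun_def M_def closure_operator_def intro!: c_ub)
  have "sc \<gamma> = c"
    unfolding sc_def by (rule Greatest_equality) (use c_clos c_scott c_le c_greatest in auto)
  then show "closure_operator (sc \<gamma>)" "scott_continuous (sc \<gamma>)" "sc \<gamma> \<le> \<gamma>"
    "\<And>\<delta>. closure_operator \<delta> \<Longrightarrow> scott_continuous \<delta> \<Longrightarrow> \<delta> \<le> \<gamma> \<Longrightarrow> \<delta> \<le> sc \<gamma>"
    using c_clos c_scott c_le c_greatest by auto
qed

end

theory Submission
  imports Defs
begin

text \<open>
  Let \<open>g x\<close> be the join of the directed set \<open>{\<gamma> u | u. u \<lless> x}\<close>. The map \<open>g\<close> is increasing, lies
  between the identity and \<open>\<gamma>\<close>, and is Scott-continuous because \<open>u \<lless> \<Squnion>D\<close> implies \<open>u \<lless> d\<close> for some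
  \<open>d \<in> D\<close>. It is idempotent: if \<open>u \<lless> g x\<close>, then \<open>u \<le> \<gamma> v\<close> for some \<open>v \<lless> x\<close>, hence
  \<open>\<gamma> u \<le> \<gamma> v \<le> g x\<close>. So \<open>g \<le> sc \<gamma>\<close>. Conversely, by Scott continuity \<open>sc \<gamma> x\<close> is the join of the
  \<open>sc \<gamma> u \<le> \<gamma> u\<close> with \<open>u \<lless> x\<close>.
\<close>

lemma directed_image:
  assumes "mono f" and "directed D"
  shows "directed (f ` D)"
  unfolding directed_def
proof (intro conjI ballI)
  show "f ` D \<noteq> {}"
    using assms(2) by (simp add: directed_def)
next
  fix a b assume "a \<in> f ` D" "b \<in> f ` D"
  then obtain x y where "a = f x" "b = f y" "x \<in> D" "y \<in> D"
    by blast
  moreover from this obtain z where "z \<in> D" "x \<le> z" "y \<le> z"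
    using assms(2) unfolding directed_def by blast
  ultimately show "\<exists>c\<in>f ` D. a \<le> c \<and> b \<le> c"
    using assms(1) by (auto simp: mono_def)
qed

lemma way_belowD:
  assumes "x \<lless> y" "directed D" "isLub UNIV D s" "y \<le> s"
  obtains d where "d \<in> D" "x \<le> d"
  using assms unfolding way_below_def by blast

lemma way_below_imp_le: "x \<le> y" if "x \<lless> y"
proof -
  have "directed {y}" "isLub UNIV {y} y"
    by (auto simp: directed_def isLub_UNIV_iff)
  from that this order_refl obtain d where "d \<in> {y}" "x \<le> d"
    by (rule way_belowD)
  then show ?thesis by simp
qed

lemma way_below_le_trans: "x \<lless> z" if "x \<lless> y" "y \<le> z"
  using that unfolding way_below_def by (meson order_trans)

lemma le_way_below_trans: "x \<lless> z" if "x \<le> y" "y \<lless> z"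
  using that unfolding way_below_def by (meson order_trans)

text \<open>Replace \<open>D\<close> by the set \<open>?E\<close> of all elements way below some
  member of \<open>D\<close>. By continuity \<open>?E\<close> is again directed with join
  \<open>s\<close>, so \<open>u \<lless> s\<close> applied to \<open>?E\<close> gives
  \<open>u \<le> w \<lless> d\<close> with \<open>d\<close> in \<open>D\<close>.\<close>

lemma way_below_Lub:
  fixes u :: "'a::order"
  assumes P: "continuous_poset TYPE('a)"
    and D: "directed D" and s: "isLub UNIV D s" and u: "u \<lless> s"
  obtains d where "d \<in> D" "u \<lless> d"
proof -
  let ?E = "{w. \<exists>d\<in>D. w \<lless> d}"
  have dir: "directed {w. w \<lless> x}" and lub: "isLub UNIV {w. w \<lless> x} x" for x :: 'a
    using P by (auto simp: continuous_poset_def)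
  have "directed ?E"
    unfolding directed_def
  proof (intro conjI ballI)
    obtain d where "d \<in> D" using D by (auto simp: directed_def)
    moreover obtain w where "w \<lless> d" using dir[of d] by (auto simp: directed_def)
    ultimately show "?E \<noteq> {}" by blast
  next
    fix a b assume "a \<in> ?E" "b \<in> ?E"
    then obtain d e where "a \<lless> d" "b \<lless> e" "d \<in> D" "e \<in> D" by blast
    \<comment> \<open>Directedness is used twice: in \<open>D\<close>, to bring \<open>a\<close> and
      \<open>b\<close> way below one \<open>c\<close>, and then in the set of elements way below
      \<open>c\<close>.\<close>
    moreover from this obtain c where "c \<in> D" "d \<le> c" "e \<le> c"
      using D unfolding directed_def by blast
    ultimately have "a \<lless> c" "b \<lless> c" "c \<in> D"
      by (auto intro: way_below_le_trans)
    moreover from this obtain w where "w \<lless> c" "a \<le> w" "b \<le> w"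
      using dir[of c] unfolding directed_def by blast
    ultimately show "\<exists>w\<in>?E. a \<le> w \<and> b \<le> w" by blast
  qed
  moreover have "isLub UNIV ?E s"
    unfolding isLub_UNIV_iff
  proof (intro conjI ballI allI impI)
    fix w assume "w \<in> ?E"
    then obtain d where "d \<in> D" "w \<lless> d" by blast
    then show "w \<le> s"
      using s by (auto simp: isLub_UNIV_iff dest: way_below_imp_le intro: order_trans)
  next
    fix t assume "\<forall>w\<in>?E. w \<le> t"
    \<comment> \<open>Each \<open>d\<close> is the join of the elements way below it, and these all
      lie in \<open>?E\<close>.\<close>
    then have "\<forall>d\<in>D. d \<le> t"
      using lub unfolding isLub_UNIV_iff by blast
    then show "s \<le> t"
      using s by (simp add: isLub_UNIV_iff)
  qed
  ultimately obtain w where "w \<in> ?E" "u \<le> w"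
    using u order_refl way_belowD by blast
  then show thesis
    using that by (blast intro: le_way_below_trans)
qed

theorem proposition4p14:
  fixes \<gamma> :: "'a::order \<Rightarrow> 'a"
  assumes "continuous_domain TYPE('a)"
    and "closure_operator \<gamma>"
  shows "\<forall>x. isLub UNIV (\<gamma> ` {u. u \<lless> x}) (sc \<gamma> x) \<and> isLub UNIV {\<gamma> u |u. u \<lless> x} (sc \<gamma> x)"
proof -
  have dcpo: "dcpo TYPE('a)" and cont: "continuous_poset TYPE('a)"
    using assms(1) by (auto simp: continuous_domain_def)
  have dir: "directed {u. u \<lless> x}" and lub: "isLub UNIV {u. u \<lless> x} x" for x :: 'a
    using cont by (auto simp: continuous_poset_def)
  have \<gamma>_mono: "mono \<gamma>" and \<gamma>_asc: "x \<le> \<gamma> x" and \<gamma>_idem: "\<gamma> (\<gamma> x) = \<gamma> x" for x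
    using assms(2) by (auto simp: closure_operator_def)
  have dir_\<gamma>: "directed (\<gamma> ` {u. u \<lless> x})" for x
    using \<gamma>_mono dir by (rule directed_image)
  then have "\<forall>x. \<exists>s. isLub UNIV (\<gamma> ` {u. u \<lless> x}) s"
    using dcpo unfolding dcpo_def by blast
  from choice[OF this] obtain g where g: "isLub UNIV (\<gamma> ` {u. u \<lless> x}) (g x)" for x
    by auto
  have g_ub: "\<gamma> u \<le> g x" if "u \<lless> x" for u x
    using g[of x] that by (simp add: isLub_UNIV_iff)
  have g_least: "g x \<le> t" if "\<And>u. u \<lless> x \<Longrightarrow> \<gamma> u \<le> t" for x t
    using g[of x] that by (simp add: isLub_UNIV_iff)
  have g_mono: "g x \<le> g y" if "x \<le> y" for x y
    using that by (intro g_least g_ub) (rule way_below_le_trans)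
  have g_asc: "x \<le> g x" for x
  proof -
    \<comment> \<open>By continuity \<open>x\<close> is the least upper bound of these
      \<open>u\<close>, so it suffices to bound each of them by \<open>g x\<close>.\<close>
    have "u \<le> g x" if "u \<lless> x" for u
      using \<gamma>_asc g_ub[OF that] by (rule order_trans)
    then show ?thesis
      using lub[of x] by (simp add: isLub_UNIV_iff)
  qed
  have g_le: "g \<le> \<gamma>"
    unfolding le_fun_def by (intro allI g_least monoD[OF \<gamma>_mono] way_below_imp_le)
  have "g (g x) \<le> g x" for x
  proof (rule g_least)
    fix u assume "u \<lless> g x"
    \<comment> \<open>The relation \<open>u \<lless> g x\<close> is tested on the directed set whose
      join defines \<open>g x\<close>.\<close>
    from this dir_\<gamma> g order_refl obtain d where "d \<in> \<gamma> ` {v. v \<lless> x}" "u \<le> d"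
      by (rule way_belowD)
    then obtain v where v: "v \<lless> x" "u \<le> \<gamma> v" by blast
    have "\<gamma> u \<le> \<gamma> (\<gamma> v)" using \<gamma>_mono v(2) by (rule monoD)
    also have "\<dots> \<le> g x" using g_ub[OF v(1)] by (simp add: \<gamma>_idem)
    finally show "\<gamma> u \<le> g x" .
  qed
  then have g_clos: "closure_operator g"
    using g_mono g_asc by (auto simp: closure_operator_def mono_def intro: antisym)
  have g_scott: "scott_continuous g"
    \<comment> \<open>Only the join of the image is unfolded; the join of \<open>D\<close> stays
      intact for \<open>way_below_Lub\<close>.\<close>
    unfolding scott_continuous_def isLub_UNIV_iff[of "g ` _"]
  proof (intro allI impI conjI ballI)
    fix D :: "'a set" and s a
    assume "isLub UNIV D s" "a \<in> g ` D"
    then show "a \<le> g s" by (auto simp: isLub_UNIV_iff intro: g_mono)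
  next
    fix D :: "'a set" and s t
    assume D: "directed D" "isLub UNIV D s" and t: "\<forall>a\<in>g ` D. a \<le> t"
    show "g s \<le> t"
    proof (rule g_least)
      fix u assume "u \<lless> s"
      with cont D obtain d where "d \<in> D" "u \<lless> d" by (rule way_below_Lub)
      then show "\<gamma> u \<le> t" using g_ub t by (blast intro: order_trans)
    qed
  qed
  note core = sc_is_core[OF dcpo assms(2)]
  have "sc \<gamma> x = g x" for x
  proof (rule antisym)
    show "g x \<le> sc \<gamma> x"
      using core(4)[OF g_clos g_scott g_le] by (simp add: le_fun_def)
    \<comment> \<open>Continuity makes \<open>x\<close> a directed join of the elements way below
      it, which \<open>sc \<gamma>\<close> preserves.\<close>
    have "isLub UNIV (sc \<gamma> ` {u. u \<lless> x}) (sc \<gamma> x)"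
      using core(2) dir lub by (simp add: scott_continuous_def)
    moreover have "sc \<gamma> u \<le> g x" if "u \<lless> x" for u
      using le_funD[OF core(3)] g_ub[OF that] by (rule order_trans)
    ultimately show "sc \<gamma> x \<le> g x"
      by (simp add: isLub_UNIV_iff)
  qed
  then show ?thesis
    using g by (simp add: setcompr_eq_image)
qed

end
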